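(* Let $k\ge2$ be an integer and $q=p^r$ with $p$ prime and $r\ge1$. For $n\ge k$ let $T_{2,3,\dots,k}(n)=\sum_{i=1}^{n-k+1}X_iX_{i+1}\cdots X_{i+k-1}\in\mathbb{F}_q[X_1,\dots,X_n]$. Then the sequence $\{S_{\mathbb{F}_q}(T_{2,3,\dots,k}(n))\}_{n=k}^{\infty}$ satisfies a homogeneous linear recurrence with integer coefficients whose characteristic polynomial is $$Q_{T,k,\mathbb{F}_q}(X)=X^k-q\sum_{l=0}^{k-2}(q-1)^lX^{k-2-l}.$$
   Context: For $F\in\mathbb{F}_q[X_1,\dots,X_n]$, $S_{\mathbb{F}_q}(F)=\sum_{\mathbf{x}\in\mathbb{F}_q^n}e^{\frac{2\pi i}{p}\mathrm{Tr}_{\mathbb{F}_q/\mathbb{F}_p}(F(\mathbf{x}))}$, with $\mathrm{Tr}_{\mathbb{F}_q/\mathbb{F}_p}$ the field trace. A sequence satisfies the homogeneous linear recurrence with characteristic polynomial $X^d-\sum_{i=1}^d c_iX^{d-i}$ if $a_n=\sum_{i=1}^d c_ia_{n-i}$ for all admissible $n$. *)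

theory Defs
  imports
    Complex_Main
    "HOL-Library.Poly_Mapping"
    "HOL-Library.Cardinality"
    "HOL-Computational_Algebra.Computational_Algebra"
begin

text \<open>A monomial is a finitely supported exponent vector \<open>nat \<Rightarrow>\<^sub>0 nat\<close>. Addition and
  multiplication of polynomials are those of type \<open>\<Rightarrow>\<^sub>0\<close> (multiplication is convolution).\<close>

type_synonym 'a mpoly = "(nat \<Rightarrow>\<^sub>0 nat) \<Rightarrow>\<^sub>0 'a"

definition Var :: "nat \<Rightarrow> 'a::comm_semiring_1 mpoly" where
  "Var i = Poly_Mapping.single (Poly_Mapping.single i 1) 1"

definition mpoly_eval :: "(nat \<Rightarrow> 'a::comm_semiring_1) \<Rightarrow> 'a mpoly \<Rightarrow> 'a" where
  "mpoly_eval x F = (\<Sum>m\<in>Poly_Mapping.keys F.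
     Poly_Mapping.lookup F m * (\<Prod>i\<in>Poly_Mapping.keys m. x i ^ Poly_Mapping.lookup m i))"

text \<open>The trace from the field with \<open>p ^ r\<close> elements to its prime field, as the sum of the
  conjugates. Its value is an element of the big field lying in the prime subfield.\<close>

definition field_trace :: "nat \<Rightarrow> nat \<Rightarrow> 'a::comm_semiring_1 \<Rightarrow> 'a" where
  "field_trace p r x = (\<Sum>j<r. x ^ (p ^ j))"

text \<open>For an element of the prime subfield of a field of characteristic \<open>p\<close> this is the
  representative in \<open>{0..p-1}\<close>; on other elements the value is irrelevant.\<close>

definition prime_subfield_rep :: "'a::semiring_1 \<Rightarrow> nat" where
  "prime_subfield_rep y = (LEAST m. of_nat m = y)"

lemma field_trace_in_prime_subfield:
  fixes x :: "'a::finite_field"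
  assumes p: "prime p" and q: "CARD('a) = p ^ r"
  shows "of_nat (prime_subfield_rep (field_trace p r x)) = field_trace p r x"
    and "prime_subfield_rep (field_trace p r x) < p"
proof -
  define t where "t = field_trace p r x"
  have prime_char: "prime CHAR('a)"
    by (rule prime_CHAR_semidom) (simp add: finite_imp_CHAR_pos)
  have "(\<Sum>y\<in>(UNIV :: 'a set). y + 1) = (\<Sum>y\<in>UNIV. y)"
    by (rule sum.reindex_bij_witness[of _ "\<lambda>y. y - 1" "\<lambda>y. y + 1"]) auto
  then have "of_nat (CARD('a)) = (0 :: 'a)"
    by (simp add: sum.distrib)
  then have "CHAR('a) dvd p ^ r"
    unfolding q by (simp only: of_nat_eq_0_iff_char_dvd)
  then have char: "CHAR('a) = p"
    using prime_char p prime_dvd_power primes_dvd_imp_eq by blast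
  have p1: "p > 1" using p by (rule prime_gt_1_nat)
  have tp: "y ^ p = y" if "y = t \<or> (\<exists>m. y = of_nat m)" for y :: 'a
  proof -
    have "t ^ p = (\<Sum>j<r. x ^ (p ^ Suc j))"
      unfolding t_def field_trace_def
      by (subst freshmans_dream_sum) (use char p in \<open>auto simp flip: power_mult simp: mult_ac\<close>)
    also have "\<dots> = (\<Sum>j<Suc r. x ^ (p ^ j)) - x"
      by (subst sum.lessThan_Suc_shift) simp
    also have "\<dots> = t"
      using finite_field_power_card_eq_same[of x] q by (simp add: t_def field_trace_def)
    finally have t: "t ^ p = t" .
    have "(of_nat m :: 'a) ^ p = of_nat m" for m
      by (induction m) (use char p p1 in \<open>auto simp: freshmans_dream power_0_left\<close>)
    with t that show ?thesis by auto
  qed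
  define P :: "'a poly" where "P = monom 1 p - monom 1 1"
  have "coeff P p = 1" using p1 by (simp add: P_def)
  then have "P \<noteq> 0" by auto
  have "degree P \<le> p"
    unfolding P_def by (rule degree_diff_le) (use p1 in \<open>auto simp: degree_monom_eq\<close>)
  with \<open>P \<noteq> 0\<close> have le: "card {y. poly P y = 0} \<le> p"
    using card_poly_roots_bound order_trans by blast
  have inj: "inj_on (of_nat :: nat \<Rightarrow> 'a) {..<p}"
  proof (rule linorder_inj_onI')
    fix m n assume "m < n" "n \<in> {..<p}"
    then have "\<not> p dvd n - m" by (auto dest: dvd_imp_le)
    then have "of_nat (n - m) \<noteq> (0 :: 'a)" by (simp only: of_nat_eq_0_iff_char_dvd char not_False_eq_True)
    with \<open>m < n\<close> show "(of_nat m :: 'a) \<noteq> of_nat n" by (simp add: of_nat_diff)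
  qed
  have sub: "of_nat ` {..<p} \<subseteq> {y. poly P y = 0}"
    using tp by (auto simp: P_def poly_monom)
  have "of_nat ` {..<p} = {y. poly P y = 0}"
    by (rule card_seteq[OF _ sub]) (use le inj in \<open>simp_all add: card_image\<close>)
  moreover have "t \<in> {y. poly P y = 0}" using tp[of t] by (simp add: P_def poly_monom)
  ultimately have "t \<in> of_nat ` {..<p}" by simp
  then obtain m where m: "m < p" "of_nat m = t" by auto
  show "of_nat (prime_subfield_rep (field_trace p r x)) = field_trace p r x"
    using m(2) unfolding prime_subfield_rep_def t_def by (rule LeastI)
  show "prime_subfield_rep (field_trace p r x) < p"
    using m Least_le[of "\<lambda>m. of_nat m = t" m] by (simp add: prime_subfield_rep_def t_def)
qed

text \<open>Points of affine \<open>n\<close>-space are extensional functions on \<open>{1..n}\<close>, so that each point is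
  counted once. \<open>F\<close> is meant to involve only the variables \<open>Var 1, \<dots>, Var n\<close>.\<close>

definition exp_sum :: "nat \<Rightarrow> nat \<Rightarrow> nat \<Rightarrow> 'a::finite_field mpoly \<Rightarrow> complex" where
  "exp_sum p r n F = (\<Sum>x\<in>{1..n} \<rightarrow>\<^sub>E UNIV.
     exp (2 * of_real pi * \<i> / of_nat p
       * of_nat (prime_subfield_rep (field_trace p r (mpoly_eval x F)))))"

definition trapezoid_poly :: "nat \<Rightarrow> nat \<Rightarrow> 'a::comm_semiring_1 mpoly" where
  "trapezoid_poly k n = (\<Sum>i=1..n-k+1. \<Prod>j=i..i+k-1. Var j)"

text \<open>The sequence \<open>a m, a (m+1), \<dots>\<close> satisfies a homogeneous linear recurrence with integer
  coefficients and characteristic polynomial \<open>Q\<close>. Its members below index \<open>m\<close> are not used.\<close>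

definition satisfies_recurrence :: "int poly \<Rightarrow> nat \<Rightarrow> (nat \<Rightarrow> complex) \<Rightarrow> bool" where
  "satisfies_recurrence Q m a \<longleftrightarrow> (\<exists>d\<ge>1. \<exists>c :: nat \<Rightarrow> int.
     Q = monom 1 d - (\<Sum>i=1..d. monom (c i) (d - i)) \<and>
     (\<forall>n\<ge>m+d. a n = (\<Sum>i=1..d. of_int (c i) * a (n - i))))"

definition trapezoid_charpoly :: "nat \<Rightarrow> nat \<Rightarrow> int poly" where
  "trapezoid_charpoly k q =
     monom 1 k - smult (int q) (\<Sum>l=0..k-2. monom ((int q - 1) ^ l) (k - 2 - l))"

end

theory Submission
  imports
    Defs
    "HOL-Number_Theory.Cong"
    "HOL-Analysis.Complex_Transcendental"
begin

text \<open>Split the points according to the last zero among the coordinates \<open>n - k + 1, \<dots>, n - 1\<close>.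
  If all these coordinates are nonzero, the sum over \<open>x n\<close> vanishes by orthogonality, because
  \<open>x n\<close> occurs only in the last monomial, with a nonzero coefficient. If the last zero is at
  \<open>n - 1 - l\<close>, where \<open>0 \<le> l \<le> k - 2\<close>, then every monomial outside the trapezoid polynomial in
  \<open>n - 2 - l\<close> variables contains that coordinate; the \<open>l\<close> coordinates after it are arbitrary
  nonzero elements and \<open>x n\<close> is free, which gives \<open>q (q - 1)\<^sup>l\<close> times the sum for \<open>n - 2 - l\<close>.\<close>

section \<open>Evaluation of polynomials given by finitely supported coefficient maps\<close>

lemma mpoly_eval_superset:
  assumes "finite K" "Poly_Mapping.keys F \<subseteq> K"
  shows "mpoly_eval x F =
    (\<Sum>m\<in>K. Poly_Mapping.lookup F m * (\<Prod>i\<in>Poly_Mapping.keys m. x i ^ Poly_Mapping.lookup m i))"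
  unfolding mpoly_eval_def
  by (rule sum.mono_neutral_left) (use assms in \<open>auto simp: in_keys_iff\<close>)

lemma mpoly_eval_add: "mpoly_eval x (F + G) = mpoly_eval x F + mpoly_eval x G"
proof -
  \<comment> \<open>The supports of \<open>F\<close>, \<open>G\<close> and \<open>F + G\<close> may
    differ, and terms may cancel; all three sums are extended by zero terms to one index
    set.\<close>
  let ?K = "Poly_Mapping.keys F \<union> Poly_Mapping.keys G"
  show ?thesis
    using Poly_Mapping.keys_add[of F G]
    by (simp add: mpoly_eval_superset[of ?K] lookup_add distrib_right sum.distrib)
qed

lemma mpoly_eval_sum: "mpoly_eval x (\<Sum>i\<in>I. F i) = (\<Sum>i\<in>I. mpoly_eval x (F i))"
  by (induction I rule: infinite_finite_induct) (simp_all add: mpoly_eval_add, simp_all add: mpoly_eval_def)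

lemma prod_Var:
  "finite A \<Longrightarrow> (\<Prod>j\<in>A. Var j) = Poly_Mapping.single (\<Sum>j\<in>A. Poly_Mapping.single j 1) 1"
  by (induction A rule: finite_induct) (simp_all add: Var_def mult_single)

lemma mpoly_eval_prod_Var:
  assumes "finite A"
  shows "mpoly_eval x (\<Prod>j\<in>A. Var j) = (\<Prod>j\<in>A. x j)"
proof -
  \<comment> \<open>Since the factors are distinct variables, the exponent vector \<open>e\<close>
    is the indicator function of \<open>A\<close>: the product is a single squarefree
    monomial.\<close>
  define e :: "nat \<Rightarrow>\<^sub>0 nat" where "e = (\<Sum>j\<in>A. Poly_Mapping.single j 1)"
  have lookup_e: "Poly_Mapping.lookup e i = (if i \<in> A then 1 else 0)" for i
    using assms by (simp add: e_def lookup_sum lookup_single when_def)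
  then have "Poly_Mapping.keys e = A"
    by (auto simp: in_keys_iff simp del: neq0_conv split: if_splits)
  then show ?thesis
    by (simp only: prod_Var[OF assms] e_def[symmetric]) (simp add: mpoly_eval_def lookup_e)
qed

lemma mpoly_eval_trapezoid_poly:
  "mpoly_eval x (trapezoid_poly k n) = (\<Sum>i=1..n-k+1. \<Prod>j=i..i+k-1. x j)"
  unfolding trapezoid_poly_def mpoly_eval_sum by (intro sum.cong refl mpoly_eval_prod_Var) simp

section \<open>The additive character of the field given by the trace\<close>

definition trace_char :: "nat \<Rightarrow> nat \<Rightarrow> 'a::finite_field \<Rightarrow> complex" where
  "trace_char p r y =
    exp (2 * of_real pi * \<i> / of_nat p * of_nat (prime_subfield_rep (field_trace p r y)))"

lemma exp_sum_eq_sum_trace_char: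
  "exp_sum p r n F = (\<Sum>x\<in>{1..n} \<rightarrow>\<^sub>E UNIV. trace_char p r (mpoly_eval x F))"
  by (simp add: exp_sum_def trace_char_def)

text \<open>Translation by 1 permutes the ring, so adding 1 to each summand leaves the sum of all
  elements unchanged.\<close>

lemma of_nat_CARD_eq_0: "of_nat CARD('a::{finite,ring_1}) = (0 :: 'a)"
proof -
  have "(\<Sum>y\<in>(UNIV :: 'a set). y + 1) = (\<Sum>y\<in>UNIV. y)"
    by (rule sum.reindex_bij_witness[of _ "\<lambda>y. y - 1" "\<lambda>y. y + 1"]) auto
  then show ?thesis
    by (simp add: sum.distrib)
qed

lemma CHAR_eq_of_card_eq_prime_power:
  assumes "prime p" "CARD('a::finite_field) = p ^ r"
  shows "CHAR('a) = p"
proof -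
  have "prime CHAR('a)"
    by (rule prime_CHAR_semidom) (simp add: finite_imp_CHAR_pos)
  moreover have "CHAR('a) dvd p ^ r"
    using of_nat_CARD_eq_0[where 'a = 'a] assms(2) by (simp only: of_nat_eq_0_iff_char_dvd)
  ultimately show ?thesis
    using assms(1) prime_dvd_power primes_dvd_imp_eq by blast
qed

text \<open>Each conjugate \<open>x ^ (p ^ j)\<close> is an iterated Frobenius image, hence additive
  in characteristic \<open>p\<close>.\<close>

lemma field_trace_add:
  assumes "prime p" "CARD('a::finite_field) = p ^ r"
  shows "field_trace p r (x + y :: 'a) = field_trace p r x + field_trace p r y"
  using assms CHAR_eq_of_card_eq_prime_power[OF assms]
  by (simp add: field_trace_def freshmans_dream' sum.distrib)

text \<open>As a polynomial in its argument, the trace has degree \<open>p ^ (r - 1)\<close>, so it has fewer than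
  \<open>p ^ r\<close> zeros.\<close>
lemma field_trace_nonzero:
  assumes "prime p" "r \<ge> 1" "CARD('a::finite_field) = p ^ r"
  shows "\<exists>t::'a. field_trace p r t \<noteq> 0"
proof (rule ccontr)
  assume "\<nexists>t::'a. field_trace p r t \<noteq> 0"
  then have tr0: "field_trace p r t = 0" for t :: 'a
    by blast
  have p1: "p > 1"
    using assms(1) by (rule prime_gt_1_nat)
  define P :: "'a poly" where "P = (\<Sum>j<r. monom 1 (p ^ j))"
  \<comment> \<open>Only \<open>j = 0\<close> contributes to the linear term, as
    \<open>p ^ j = 1\<close> forces \<open>j = 0\<close>.\<close>
  have "coeff P 1 = (\<Sum>j<r. if j = 0 then 1 else 0)"
    unfolding P_def coeff_sum by (rule sum.cong) (use p1 in \<open>auto simp: coeff_monom\<close>)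
  then have "coeff P 1 = 1"
    using assms(2) by simp
  then have "P \<noteq> 0"
    by auto
  have "degree P \<le> p ^ (r - 1)"
    unfolding P_def
    by (rule degree_sum_le) (use p1 in \<open>auto simp: degree_monom_eq intro: power_increasing\<close>)
  also have "\<dots> < p ^ r"
    using p1 assms(2) by (simp add: power_strict_increasing)
  also have "p ^ r = card {x. poly P x = 0}"
    using tr0 assms(3) by (simp add: P_def poly_sum poly_monom field_trace_def)
  also have "\<dots> \<le> degree P"
    using \<open>P \<noteq> 0\<close> by (rule card_poly_roots_bound)
  finally show False
    by simp
qed

text \<open>Representatives of traces add up only modulo \<open>p\<close>; this suffices because the
  root of unity depends only on the exponent modulo \<open>p\<close>.\<close>

lemma trace_char_add:
  assumes "prime p" "CARD('a::finite_field) = p ^ r"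
  shows "trace_char p r (x + y :: 'a) = trace_char p r x * trace_char p r y"
proof -
  define R :: "'a \<Rightarrow> nat" where "R z = prime_subfield_rep (field_trace p r z)" for z
  have R: "of_nat (R z) = field_trace p r z" for z :: 'a
    unfolding R_def by (rule field_trace_in_prime_subfield(1)[OF assms])
  have "of_nat (R (x + y)) = (of_nat (R x + R y) :: 'a)"
    by (simp add: R field_trace_add[OF assms])
  then have "R (x + y) mod p = (R x + R y) mod p"
    by (simp only: of_nat_eq_iff_cong_CHAR CHAR_eq_of_card_eq_prime_power[OF assms] cong_def)
  moreover have "1 \<le> p"
    using prime_gt_0_nat[OF assms(1)] by simp
  ultimately have "exp (2 * of_real pi * \<i> * of_nat (R (x + y)) / of_nat p)
      = exp (2 * of_real pi * \<i> * of_nat (R x + R y) / of_nat p)"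
    using complex_root_unity_eq by blast
  then show ?thesis
    by (simp add: trace_char_def flip: R_def exp_add) (simp add: distrib_left add_divide_distrib)
qed

text \<open>A nonzero trace has its representative strictly between 0 and \<open>p\<close>, which
  yields a \<open>p\<close>-th root of unity other than 1.\<close>

lemma trace_char_nontrivial:
  assumes "prime p" "r \<ge> 1" "CARD('a::finite_field) = p ^ r"
  shows "\<exists>t::'a. trace_char p r t \<noteq> 1"
proof -
  obtain t :: 'a where t: "field_trace p r t \<noteq> 0"
    using field_trace_nonzero[OF assms] by blast
  let ?R = "prime_subfield_rep (field_trace p r t)"
  have "\<not> p dvd ?R"
  proof
    assume "p dvd ?R"
    then have "?R = 0"
      using field_trace_in_prime_subfield(2)[OF assms(1,3), of t] by (auto dest: dvd_imp_le)
    then show False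
      using field_trace_in_prime_subfield(1)[OF assms(1,3), of t] t by simp
  qed
  then have "trace_char p r t \<noteq> 1"
    using complex_root_unity_eq_1[of p ?R] prime_gt_0_nat[OF assms(1)] by (simp add: trace_char_def)
  then show ?thesis ..
qed

section \<open>Partial sums over points with prescribed zero and nonzero coordinates\<close>

lemma sum_PiE_Un_restrict:
  fixes g :: "('i \<Rightarrow> 'b) \<Rightarrow> 'c::comm_semiring_1"
  assumes "finite B" "A \<inter> B = {}"
  shows "(\<Sum>x\<in>Pi\<^sub>E (A \<union> B) F. g (restrict x A))
    = of_nat (\<Prod>b\<in>B. card (F b)) * (\<Sum>x\<in>Pi\<^sub>E A F. g x)"
  using assms
proof (induction B rule: finite_induct)
  case empty
  have "restrict x A = x" if "x \<in> Pi\<^sub>E A F" for x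
    using that by (simp add: PiE_restrict)
  then show ?case
    by simp
next
  case (insert b B)
  then have b: "b \<notin> A \<union> B" "b \<notin> A"
    by auto
  \<comment> \<open>The coordinate \<open>b\<close> lies outside \<open>A\<close>, so the summand
    ignores it and summing over its values only contributes the factor
    \<open>card (F b)\<close>.\<close>
  have "restrict (x(b := y)) A = restrict x A" for x :: "'i \<Rightarrow> 'b" and y
    using b(2) by (auto simp: restrict_def)
  then have "(\<Sum>x\<in>Pi\<^sub>E (insert b (A \<union> B)) F. g (restrict x A))
      = (\<Sum>z\<in>F b \<times> Pi\<^sub>E (A \<union> B) F. g (restrict (snd z) A))"
    by (simp only: PiE_insert_eq sum.reindex[OF inj_combinator[OF b(1)]])
      (simp add: case_prod_unfold)
  also have "\<dots> = of_nat (card (F b)) * (\<Sum>x\<in>Pi\<^sub>E (A \<union> B) F. g (restrict x A))"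
    by (simp add: sum.cartesian_product' sum_distrib_left)
  also have "(\<Sum>x\<in>Pi\<^sub>E (A \<union> B) F. g (restrict x A))
      = of_nat (\<Prod>b\<in>B. card (F b)) * (\<Sum>x\<in>Pi\<^sub>E A F. g x)"
    using insert.prems by (intro insert.IH) auto
  also have "of_nat (card (F b)) * \<dots> = of_nat (\<Prod>b\<in>insert b B. card (F b)) * (\<Sum>x\<in>Pi\<^sub>E A F. g x)"
    using insert.hyps by (simp add: mult.assoc)
  finally show ?case
    by simp
qed

text \<open>Shifting \<open>x n\<close> by \<open>t / W x\<close> permutes \<open>N\<close> and adds
  \<open>t\<close> to the value of the polynomial. The sum therefore equals itself times
  \<open>trace_char p r t\<close>, and \<open>t\<close> is chosen so that this factor is not
  1.\<close>

lemma sum_trace_char_nonzero_window: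
  fixes k n p r :: nat
  defines "N \<equiv> {x \<in> {1..n} \<rightarrow>\<^sub>E (UNIV :: 'a::finite_field set). \<forall>j\<in>{n-k+1..<n}. x j \<noteq> 0}"
  assumes "prime p" "r \<ge> 1" "CARD('a) = p ^ r" "1 \<le> k" "k \<le> n"
  shows "(\<Sum>x\<in>N. trace_char p r (mpoly_eval x (trapezoid_poly k n))) = 0"
proof -
  obtain t :: 'a where t: "trace_char p r t \<noteq> 1"
    using trace_char_nontrivial[OF assms(2-4)] by blast
  define E :: "(nat \<Rightarrow> 'a) \<Rightarrow> 'a" where "E x = mpoly_eval x (trapezoid_poly k n)" for x
  \<comment> \<open>\<open>W x\<close> is the cofactor of \<open>x n\<close> in the last monomial.
    It does not involve \<open>x n\<close>, so the shift \<open>h\<close> preserves it and shifts by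
    opposite amounts are mutually inverse.\<close>
  define W :: "(nat \<Rightarrow> 'a) \<Rightarrow> 'a" where "W x = (\<Prod>j\<in>{n-k+1..<n}. x j)" for x
  define h :: "'a \<Rightarrow> (nat \<Rightarrow> 'a) \<Rightarrow> nat \<Rightarrow> 'a" where "h u x = x(n := x n + u / W x)" for u x
  have W_h: "W (h u x) = W x" for u x
    unfolding W_def by (rule prod.cong) (auto simp: h_def)
  have h_inv: "h u (h v x) = x" if "u + v = 0" for u v x
  proof -
    have "h u (h v x) = x(n := x n + (u + v) / W x)"
      unfolding h_def[of u] W_h by (simp add: h_def add_divide_distrib add_ac)
    then show ?thesis
      using that by simp
  qed
  have h_N: "h u x \<in> N" if "x \<in> N" for u x
    using that assms(5,6) by (auto simp: N_def h_def PiE_iff extensional_def)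
  have E_split: "E x = (\<Sum>i=1..n-k. \<Prod>j=i..i+k-1. x j) + W x * x n" for x
  proof -
    have "{n-k+1..n-k+k} = insert n {n-k+1..<n}"
      using assms(5,6) by auto
    then have "(\<Prod>j=n-k+1..n-k+k. x j) = W x * x n"
      by (simp add: W_def mult.commute)
    then show ?thesis
      by (simp add: E_def mpoly_eval_trapezoid_poly)
  qed
  have E_h: "E (h t x) = E x + t" if "x \<in> N" for x
  proof -
    have "W x \<noteq> 0"
      using that by (simp add: W_def N_def)
    moreover have "(\<Sum>i=1..n-k. \<Prod>j=i..i+k-1. h t x j) = (\<Sum>i=1..n-k. \<Prod>j=i..i+k-1. x j)"
      by (intro sum.cong prod.cong refl) (use assms(5) in \<open>auto simp: h_def\<close>)
    ultimately show ?thesis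
      unfolding E_split W_h by (simp add: h_def distrib_left add_ac)
  qed
  have "(\<Sum>x\<in>N. trace_char p r (E x)) = (\<Sum>x\<in>N. trace_char p r (E (h t x)))"
    by (rule sum.reindex_bij_witness[of _ "h t" "h (- t)"]) (auto simp: h_inv h_N)
  also have "\<dots> = (\<Sum>x\<in>N. trace_char p r (E x) * trace_char p r t)"
    by (rule sum.cong) (simp_all add: E_h trace_char_add[OF assms(2,4)])
  also have "\<dots> = (\<Sum>x\<in>N. trace_char p r (E x)) * trace_char p r t"
    by (simp add: sum_distrib_right)
  finally show ?thesis
    using t by (simp add: E_def)
qed

text \<open>By \<open>n \<le> m + k\<close> no monomial starts after position \<open>m + 1\<close>.
  Hence each one either contains the zero coordinate or ends at or before \<open>m\<close>.\<close>

lemma mpoly_eval_trapezoid_poly_zero: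
  fixes x :: "nat \<Rightarrow> 'a::comm_semiring_1"
  assumes "x (m + 1) = 0" "k \<le> m" "m + 2 \<le> n" "n \<le> m + k"
  shows "mpoly_eval x (trapezoid_poly k n) = mpoly_eval (restrict x {1..m}) (trapezoid_poly k m)"
proof -
  have "(\<Sum>i=1..n-k+1. \<Prod>j=i..i+k-1. x j) = (\<Sum>i=1..m-k+1. \<Prod>j=i..i+k-1. x j)"
  proof (intro sum.mono_neutral_right ballI)
    fix i assume "i \<in> {1..n-k+1} - {1..m-k+1}"
    then have "m + 1 \<in> {i..i+k-1}"
      using assms(2-4) by auto
    then show "(\<Prod>j=i..i+k-1. x j) = 0"
      using assms(1) by (meson finite_atLeastAtMost prod_zero)
  qed (use assms in auto)
  also have "\<dots> = (\<Sum>i=1..m-k+1. \<Prod>j=i..i+k-1. restrict x {1..m} j)"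
    by (intro sum.cong prod.cong refl) (use assms(2) in auto)
  finally show ?thesis
    by (simp add: mpoly_eval_trapezoid_poly)
qed

text \<open>With \<open>m = n - 2 - l\<close> the two bounds become \<open>n \<le> m + k\<close> and
  \<open>k \<le> m\<close>, so the value depends only on the first \<open>m\<close> coordinates; the
  factor counts the completions at \<open>m + 1, ..., n\<close>.\<close>

lemma sum_trace_char_last_zero:
  fixes k l n p r :: nat
  defines "A \<equiv> {x \<in> {1..n} \<rightarrow>\<^sub>E (UNIV :: 'a::finite_field set).
    x (n-1-l) = 0 \<and> (\<forall>j\<in>{n-l..<n}. x j \<noteq> 0)}"
  assumes "l + 2 \<le> k" "k + l + 2 \<le> n"
  shows "(\<Sum>x\<in>A. trace_char p r (mpoly_eval x (trapezoid_poly k n)))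
    = of_nat (CARD('a) * (CARD('a) - 1) ^ l) * exp_sum p r (n-2-l) (trapezoid_poly k (n-2-l) :: 'a mpoly)"
proof -
  define m where "m = n-2-l"
  have n: "n = m + l + 2"
    using assms(3) by (simp add: m_def)
  \<comment> \<open>The conditions concern single coordinates, so \<open>A\<close> is a product set
    with factors \<open>F j\<close>; the nonzero window stops before \<open>n\<close>, which leaves
    \<open>F n\<close> equal to the whole field.\<close>
  define F :: "nat \<Rightarrow> 'a set"
    where "F j = (if j = m + 1 then {0} else if j \<in> {m+2..<n} then - {0} else UNIV)" for j
  have "{1..m} \<union> {m+1..n} = {1..n}"
    using n by auto
  moreover have "A = Pi\<^sub>E {1..n} F"
    unfolding A_def n by (auto simp: PiE_iff F_def n extensional_def split: if_splits)
  ultimately have A: "A = Pi\<^sub>E ({1..m} \<union> {m+1..n}) F"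
    by simp
  have "{m+1..n} = insert (m+1) (insert n {m+2..<n})"
    using n by auto
  then have "(\<Prod>j\<in>{m+1..n}. card (F j)) = CARD('a) * (CARD('a) - 1) ^ l"
    using n by (simp add: F_def Compl_eq_Diff_UNIV card_Diff_singleton)
  moreover have "Pi\<^sub>E {1..m} F = {1..m} \<rightarrow>\<^sub>E UNIV"
    by (rule PiE_cong) (simp add: F_def)
  moreover have "(\<Sum>x\<in>A. trace_char p r (mpoly_eval x (trapezoid_poly k n)))
      = (\<Sum>x\<in>A. trace_char p r (mpoly_eval (restrict x {1..m}) (trapezoid_poly k m)))"
  proof (rule sum.cong[OF refl])
    fix x assume "x \<in> A"
    then have "x (m + 1) = 0"
      by (simp add: A_def n)
    then show "trace_char p r (mpoly_eval x (trapezoid_poly k n))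
        = trace_char p r (mpoly_eval (restrict x {1..m}) (trapezoid_poly k m))"
      using mpoly_eval_trapezoid_poly_zero[of x m k n] assms(2,3) n by simp
  qed
  ultimately show ?thesis
    unfolding m_def[symmetric]
    using sum_PiE_Un_restrict[of "{m+1..n}" "{1..m}" "\<lambda>x. trace_char p r (mpoly_eval x (trapezoid_poly k m))" F]
    by (simp add: A exp_sum_eq_sum_trace_char)
qed

section \<open>Partition by the last zero and the resulting recurrence\<close>

lemma exp_sum_trapezoid_poly_rec:
  fixes k n p r :: nat
  assumes "prime p" "r \<ge> 1" "CARD('a::finite_field) = p ^ r" "2 \<le> k" "2 * k \<le> n"
  shows "exp_sum p r n (trapezoid_poly k n :: 'a mpoly) = (\<Sum>l=0..k-2.
    of_nat (CARD('a) * (CARD('a) - 1) ^ l) * exp_sum p r (n-2-l) (trapezoid_poly k (n-2-l) :: 'a mpoly))"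
proof -
  let ?X = "{1..n} \<rightarrow>\<^sub>E (UNIV :: 'a set)"
  define N where "N = {x \<in> ?X. \<forall>j\<in>{n-k+1..<n}. x j \<noteq> 0}"
  define A where "A l = {x \<in> ?X. x (n-1-l) = 0 \<and> (\<forall>j\<in>{n-l..<n}. x j \<noteq> 0)}" for l
  let ?f = "\<lambda>x :: nat \<Rightarrow> 'a. trace_char p r (mpoly_eval x (trapezoid_poly k n))"
  have fin: "finite ?X"
    by (simp add: finite_PiE)
  have cover: "?X = N \<union> (\<Union>l\<in>{0..k-2}. A l)"
  proof
    show "?X \<subseteq> N \<union> (\<Union>l\<in>{0..k-2}. A l)"
    proof
      fix x assume x: "x \<in> ?X"
      show "x \<in> N \<union> (\<Union>l\<in>{0..k-2}. A l)"
      proof (cases "x \<in> N")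
        case False
        let ?Z = "{j \<in> {n-k+1..<n}. x j = 0}"
        \<comment> \<open>The rightmost zero \<open>j\<close> of the window determines
          \<open>l = n - 1 - j\<close>; from \<open>j \<ge> n - k + 1\<close> follows
          \<open>l \<le> k - 2\<close>.\<close>
        define j where "j = Max ?Z"
        have "?Z \<noteq> {}"
          using False x by (auto simp: N_def)
        then have "j \<in> ?Z"
          unfolding j_def by (intro Max_in) auto
        moreover have "x i \<noteq> 0" if "j < i" "i < n" for i
        proof
          assume "x i = 0"
          then have "i \<in> ?Z"
            using that \<open>j \<in> ?Z\<close> by auto
          then have "i \<le> j"
            unfolding j_def by (intro Max_ge) auto
          then show False
            using that by simp
        qed
        ultimately have "x \<in> A (n-1-j)" "n-1-j \<in> {0..k-2}"
          using x assms(5) by (auto simp: A_def)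
        then show ?thesis
          by blast
      qed simp
    qed
  qed (auto simp: N_def A_def)
  have disj: "N \<inter> (\<Union>l\<in>{0..k-2}. A l) = {}"
  proof -
    have "n-1-l \<in> {n-k+1..<n}" if "l \<in> {0..k-2}" for l
      using that assms(4,5) by auto
    then show ?thesis
      by (auto simp: N_def A_def)
  qed
  have disj_A: "A l \<inter> A l' = {}" if "l < l'" "l' \<in> {0..k-2}" for l l'
  proof -
    \<comment> \<open>For \<open>l < l'\<close> the zero required by \<open>A l\<close> lies where
      \<open>A l'\<close> requires nonzero coordinates.\<close>
    have "n-1-l \<in> {n-l'..<n}"
      using that assms(4,5) by auto
    then show ?thesis
      by (auto simp: A_def)
  qed
  have "exp_sum p r n (trapezoid_poly k n :: 'a mpoly) = sum ?f N + sum ?f (\<Union>l\<in>{0..k-2}. A l)"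
    unfolding exp_sum_eq_sum_trace_char
    by (subst cover, rule sum.union_disjoint) (use fin disj in \<open>auto simp: N_def A_def\<close>)
  also have "sum ?f N = 0"
    unfolding N_def using assms by (intro sum_trace_char_nonzero_window) auto
  also have "sum ?f (\<Union>l\<in>{0..k-2}. A l) = (\<Sum>l\<in>{0..k-2}. sum ?f (A l))"
  proof (rule sum.UNION_disjoint)
    show "\<forall>l\<in>{0..k-2}. \<forall>l'\<in>{0..k-2}. l \<noteq> l' \<longrightarrow> A l \<inter> A l' = {}"
      by (metis disj_A inf_commute linorder_neqE_nat)
  qed (use fin in \<open>auto simp: A_def\<close>)
  also have "\<dots> = (\<Sum>l=0..k-2. of_nat (CARD('a) * (CARD('a) - 1) ^ l)
      * exp_sum p r (n-2-l) (trapezoid_poly k (n-2-l) :: 'a mpoly))"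
    \<comment> \<open>For \<open>l \<le> k - 2\<close>, the bound \<open>2 * k \<le> n\<close> gives
      \<open>n - 2 - l \<ge> k\<close>, so only members of the sequence from index \<open>k\<close>
      on occur.\<close>
    unfolding A_def by (intro sum.cong refl sum_trace_char_last_zero) (use assms(4,5) in auto)
  finally show ?thesis
    by simp
qed

theorem theorem3p2:
  fixes k p r q :: nat
  assumes "k \<ge> 2"
    and "prime p"
    and "r \<ge> 1"
    and "q = p ^ r"
    and "CARD('a::finite_field) = q"
  shows "satisfies_recurrence (trapezoid_charpoly k q) k
    (\<lambda>n. exp_sum p r n (trapezoid_poly k n :: 'a mpoly))"
proof -
  let ?S = "\<lambda>n. exp_sum p r n (trapezoid_poly k n :: 'a mpoly)"
  \<comment> \<open>Read off from the characteristic polynomial with \<open>i = l + 2\<close>: the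
    term of degree \<open>k - 1\<close> is absent, hence \<open>c 1 = 0\<close>.\<close>
  define c :: "nat \<Rightarrow> int" where "c i = (if i = 1 then 0 else int q * (int q - 1) ^ (i - 2))" for i
  have shift: "(\<Sum>i=1..k. f i) = f 1 + (\<Sum>l=0..k-2. f (l + 2))" for f :: "nat \<Rightarrow> 'b::comm_monoid_add"
  proof -
    have "(\<Sum>i=1..k. f i) = f 1 + (\<Sum>i=2..k. f i)"
      using assms(1) by (simp add: sum.atLeast_Suc_atMost numeral_2_eq_2)
    also have "(\<Sum>i=2..k. f i) = (\<Sum>l=0..k-2. f (l + 2))"
      by (rule sum.reindex_bij_witness[of _ "\<lambda>l. l + 2" "\<lambda>i. i - 2"])
        (use assms(1) in \<open>auto simp del: add_2_eq_Suc'\<close>)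
    finally show ?thesis .
  qed
  \<comment> \<open>Positivity identifies the truncated difference \<open>CARD('a) - 1\<close> of
    naturals with the integer \<open>q - 1\<close> in \<open>c\<close>.\<close>
  have "q > 0"
    using assms(2,4) by (simp add: prime_gt_0_nat)
  have charpoly: "trapezoid_charpoly k q = monom 1 k - (\<Sum>i=1..k. monom (c i) (k - i))"
    unfolding shift
    by (auto simp: trapezoid_charpoly_def c_def poly_eq_iff coeff_sum sum_distrib_left intro!: sum.cong)
  have "?S n = (\<Sum>i=1..k. of_int (c i) * ?S (n - i))" if "n \<ge> k + k" for n
    unfolding shift
    using exp_sum_trapezoid_poly_rec[where 'a = 'a, of p r k n] assms that \<open>q > 0\<close>
    by (simp add: c_def of_nat_diff)
  with charpoly show ?thesis
    unfolding satisfies_recurrence_def using assms(1) by (intro exI[of _ k] exI[of _ c] conjI) auto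
qed

end
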